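(* Let $(A,B)$ be a table algebra, let $C$ be a normal closed subset of $B$, and let $\psi:A/C\to \mathrm{Mat}_s(\mathbb{C})$ be a representation of $A/C$. Then the linear map $\overline{\psi}:A\to \mathrm{Mat}_s(\mathbb{C})$ defined on the basis $B$ by $\overline{\psi}(b)=\alpha_b\,\psi(b/C)$, where $\alpha_b$ is the real number with $C^+b=\alpha_b(Cb)^+$, is a representation of $A$.
   Context: A table algebra $(A,B)$ (not necessarily commutative) is a finite-dimensional associative unital algebra $A$ over $\mathbb{C}$ with a distinguished basis $B=\{b_1=1_A,\dots,b_d\}$ such that: (I) for $a,b\in B$, $ab=\sum_{c\in B}\lambda_{abc}c$ with all $\lambda_{abc}$ nonnegative real numbers; (II) there is a semilinear (conjugate-linear) involutory anti-automorphism $^*$ of $A$ with $B^*=B$; (III) for $a,b\in B$, $\lambda_{ab1_A}=\delta_{ab^*}|a|$ with $|a|>0$, where $\delta_{ab^*}$ is $1$ if $a=b^*$ and $0$ otherwise; (IV) the map $b\mapsto|b|$, $b\in B$, extends linearly to a one-dimensional representation of $A$ (the degree map), and $|b|=|b^*|$ for all $b\in B$. For $x=\sum_{b\in B}x_bb\in A$, $|x|=\sum_b x_b|b|$ and $\mathrm{Supp}(x)=\{b\in B:x_b\ne0\}$. For $E,D\subseteq B$, $ED=\bigcup_{e\in E,d\in D}\mathrm{Supp}(ed)$ (a single element $b$ stands for $\{b\}$), $E^*=\{e^*:e\in E\}$, and $E^+=\sum_{x\in E}x\in A$. A nonempty subset $C\subseteq B$ is closed if $C^*C\subseteq C$. A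 closed subset $C$ is normal if $bC=Cb$ for every $b\in B$. Quotient: for a closed subset $C$ and $b\in B$, put $b/C=|C^+|^{-1}(CbC)^+\in A$. The sets $CbC$ partition $B$. The elements $b/C$ span a subspace $A/C$ of $A$, which is closed under multiplication and equals $eAe$ with $e=|C^+|^{-1}C^+$ idempotent; with distinguished basis $B/C=\{b/C: b\in B\}$ it is a table algebra with unit $1_A/C=e$. When $C$ is normal, for each $b\in B$ there is a unique nonzero real $\alpha_b$ with $C^+b=\alpha_b(Cb)^+$ (a known fact). A representation of $A$ or $A/C$ is a unital $\mathbb{C}$-algebra homomorphism to a matrix algebra. *)

theory Defs
  imports "HOL-Analysis.Analysis"
begin

text \<open>
  The underlying algebra is a type \<open>'a :: ring_1\<close> carrying a complex scalar multiplication
  \<open>smul\<close>. The locale \<^locale>\<open>finite_dimensional_vector_space\<close> says that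
  \<open>B\<close> is a finite basis, and \<open>representation B x b\<close> is the coordinate of \<open>x\<close> at
  \<open>b \<in> B\<close>. In particular the structure constant \<open>\<lambda>\<^sub>a\<^sub>b\<^sub>c\<close> is
  \<open>representation B (a * b) c\<close>.

  The degree map is a parameter \<open>deg\<close> on the whole algebra: the linear extension of
  \<open>b \<mapsto> |b|\<close>. Its values on \<open>B\<close> are determined by \<open>one_coord\<close>.
\<close>

locale table_algebra = finite_dimensional_vector_space smul B
  for smul :: "complex \<Rightarrow> 'a::ring_1 \<Rightarrow> 'a" and B :: "'a set" +
  fixes star :: "'a \<Rightarrow> 'a" and deg :: "'a \<Rightarrow> complex"
  assumes scale_mult_left: "smul c x * y = smul c (x * y)"
    and scale_mult_right: "x * smul c y = smul c (x * y)"
    and one_in_B: "1 \<in> B"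
    and struct_nonneg: "\<lbrakk>a \<in> B; b \<in> B; d \<in> B\<rbrakk> \<Longrightarrow> representation B (a * b) d \<in> \<real>\<^sub>\<ge>\<^sub>0"
    and star_add: "star (x + y) = star x + star y"
    and star_scale: "star (smul c x) = smul (cnj c) (star x)"
    and star_mult: "star (x * y) = star y * star x"
    and star_star: "star (star x) = x"
    and star_B: "star ` B = B"
    and one_coord: "\<lbrakk>a \<in> B; b \<in> B\<rbrakk> \<Longrightarrow>
          representation B (a * b) 1 = (if a = star b then deg a else 0)"
    and deg_pos: "b \<in> B \<Longrightarrow> deg b \<in> \<real> \<and> 0 < Re (deg b)"
    and deg_add: "deg (x + y) = deg x + deg y"
    and deg_scale: "deg (smul c x) = c * deg x"
    and deg_mult: "deg (x * y) = deg x * deg y"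
    and deg_one: "deg 1 = 1"
    and deg_star: "b \<in> B \<Longrightarrow> deg (star b) = deg b"

definition mscale :: "complex \<Rightarrow> complex^'s^'s \<Rightarrow> complex^'s^'s" where
  "mscale c M = map_matrix ((*) c) M"

text \<open>
  \<open>V\<close> is a subspace closed under multiplication and \<open>e\<close> is its unit element, which need
  not be \<open>1\<close>. Only the restriction of \<open>\<rho>\<close> to \<open>V\<close> is constrained.
\<close>

definition is_representation ::
  "(complex \<Rightarrow> 'a::ring_1 \<Rightarrow> 'a) \<Rightarrow> 'a set \<Rightarrow> 'a \<Rightarrow> ('a \<Rightarrow> complex^'s^'s) \<Rightarrow> bool" where
  "is_representation smul V e \<rho> \<longleftrightarrow>
     (\<forall>x\<in>V. \<forall>y\<in>V. \<rho> (x + y) = \<rho> x + \<rho> y) \<and>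
     (\<forall>c. \<forall>x\<in>V. \<rho> (smul c x) = mscale c (\<rho> x)) \<and>
     (\<forall>x\<in>V. \<forall>y\<in>V. \<rho> (x * y) = \<rho> x ** \<rho> y) \<and>
     \<rho> e = mat 1"

lemma vector_space_mscale: "vector_space mscale"
  by unfold_locales (simp_all add: mscale_def vec_eq_iff algebra_simps)

context table_algebra
begin

definition Supp :: "'a \<Rightarrow> 'a set" where
  "Supp x = {b \<in> B. representation B x b \<noteq> 0}"

definition set_mult :: "'a set \<Rightarrow> 'a set \<Rightarrow> 'a set" where
  "set_mult E D = (\<Union>e\<in>E. \<Union>d\<in>D. Supp (e * d))"

definition plus_sum :: "'a set \<Rightarrow> 'a" where
  "plus_sum E = (\<Sum>x\<in>E. x)"

definition closed_subset :: "'a set \<Rightarrow> bool" where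
  "closed_subset C \<longleftrightarrow> C \<noteq> {} \<and> C \<subseteq> B \<and> set_mult (star ` C) C \<subseteq> C"

definition normal_closed_subset :: "'a set \<Rightarrow> bool" where
  "normal_closed_subset C \<longleftrightarrow>
     closed_subset C \<and> (\<forall>b\<in>B. set_mult {b} C = set_mult C {b})"

definition quot_elem :: "'a set \<Rightarrow> 'a \<Rightarrow> 'a" where
  "quot_elem C b = smul (inverse (deg (plus_sum C))) (plus_sum (set_mult (set_mult C {b}) C))"

text \<open>The subspace \<open>A/C\<close>; its unit element is \<open>quot_elem C 1\<close>.\<close>

definition quot_space :: "'a set \<Rightarrow> 'a set" where
  "quot_space C = span (quot_elem C ` B)"

text \<open>Such a number exists and is unique if \<open>C\<close> is normal and \<open>b \<in> B\<close>.\<close>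

definition alpha :: "'a set \<Rightarrow> 'a \<Rightarrow> real" where
  "alpha C b = (THE r. r \<noteq> 0 \<and>
     plus_sum C * b = smul (complex_of_real r) (plus_sum (set_mult C {b})))"

definition lift_rep :: "'a set \<Rightarrow> ('a \<Rightarrow> complex^'s^'s) \<Rightarrow> 'a \<Rightarrow> complex^'s^'s" where
  "lift_rep C \<psi> = vector_space_pair.construct smul mscale B
     (\<lambda>b. mscale (complex_of_real (alpha C b)) (\<psi> (quot_elem C b)))"

lemma vector_space_pair_mscale: "vector_space_pair smul mscale"
  by (simp add: vector_space_pair_def vector_space_mscale vector_space_axioms)

lemma linear_lift_rep: "Vector_Spaces.linear smul mscale (lift_rep C \<psi>)"
  unfolding lift_rep_def
  by (rule vector_space_pair.linear_construct[OF vector_space_pair_mscale independent_Basis])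

lemma lift_rep_basis:
  "b \<in> B \<Longrightarrow> lift_rep C \<psi> b = mscale (complex_of_real (alpha C b)) (\<psi> (quot_elem C b))"
  unfolding lift_rep_def
  by (rule vector_space_pair.construct_basis[OF vector_space_pair_mscale independent_Basis])

end

end

theory Submission
  imports Defs
begin

text \<open>
  Write \<open>n = |C\<^sup>+|\<close> and \<open>e = n\<^sup>-\<^sup>1 C\<^sup>+\<close>. The reason the theorem holds is that the lifted map is
  \<open>x \<mapsto> \<psi> (e x)\<close>: normality gives \<open>CbC = Cb\<close>, so
  \<open>\<alpha>\<^sub>b (b/C) = n\<^sup>-\<^sup>1 \<alpha>\<^sub>b (Cb)\<^sup>+ = n\<^sup>-\<^sup>1 C\<^sup>+ b = e b\<close>. Multiplicativity of the lift then comes down to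
  \<open>e x e y = e x y\<close>, which follows from \<open>e x e = e x\<close>. For a basis element \<open>x = b\<close> the latter holds
  because \<open>e b\<close> is a multiple of \<open>(Cb)\<^sup>+ = (bC)\<^sup>+\<close>, and \<open>(bC)\<^sup>+\<close> is fixed by right
  multiplication with \<open>e\<close>.

  Two facts about closed subsets carry this. If \<open>D \<subseteq> B\<close> satisfies \<open>DC \<subseteq> D\<close>, then
  \<open>D\<^sup>+ c = |c| D\<^sup>+\<close> for \<open>c \<in> C\<close> (\<open>plus_sum_absorb\<close>); this is a computation of the coordinate at \<open>1\<close>
  of \<open>x c d\<^sup>*\<close> in two ways. And \<open>C\<^sup>+ b\<close> is a positive multiple of \<open>(Cb)\<^sup>+\<close>
  (\<open>plus_sum_mult_basis\<close>), so that \<open>\<alpha>\<^sub>b\<close> is meaningful: the coordinates of \<open>C\<^sup>+ b\<close> form a harmonic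
  function for the random walk given by left multiplication with \<open>e\<close>, and by the maximum
  principle such a function is constant on the orbit \<open>Cb\<close>.
\<close>

section \<open>Coordinates in a table algebra\<close>

lemma sum_nonneg_Reals:
  fixes f :: "'i \<Rightarrow> complex"
  assumes "\<And>i. i \<in> I \<Longrightarrow> f i \<in> \<real>\<^sub>\<ge>\<^sub>0"
  shows "sum f I \<in> \<real>\<^sub>\<ge>\<^sub>0"
  using assms by (simp add: complex_nonneg_Reals_iff sum_nonneg)

lemma sum_nonneg_Reals_eq_0_iff:
  fixes f :: "'i \<Rightarrow> complex"
  assumes "finite I" "\<And>i. i \<in> I \<Longrightarrow> f i \<in> \<real>\<^sub>\<ge>\<^sub>0"
  shows "sum f I = 0 \<longleftrightarrow> (\<forall>i\<in>I. f i = 0)"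
proof
  assume "sum f I = 0"
  then have "(\<Sum>i\<in>I. Re (f i)) = 0"
    by (metis Re_sum zero_complex.sel(1))
  then have "\<forall>i\<in>I. Re (f i) = 0"
    using assms by (subst (asm) sum_nonneg_eq_0_iff) (auto simp: complex_nonneg_Reals_iff)
  then show "\<forall>i\<in>I. f i = 0"
    using assms(2) by (auto simp: complex_nonneg_Reals_iff complex_eq_iff)
qed simp

context table_algebra
begin

abbreviation coord :: "'a \<Rightarrow> 'a \<Rightarrow> complex" where
  "coord \<equiv> representation B"

lemma coord_scale: "coord (smul c x) b = c * coord x b"
  by (simp add: representation_scale independent_Basis span_Basis)

lemma coord_sum: "coord (sum f I) b = (\<Sum>i\<in>I. coord (f i) b)"
  by (simp add: representation_sum independent_Basis span_Basis)

lemma coord_basis: "a \<in> B \<Longrightarrow> coord a b = (if b = a then 1 else 0)"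
  by (simp add: representation_basis independent_Basis)

lemma sum_coord: "(\<Sum>b\<in>B. smul (coord x b) b) = x"
  by (rule sum_representation_eq) (simp_all add: independent_Basis span_Basis finite_Basis)

lemma coord_eqI:
  assumes "\<And>b. b \<in> B \<Longrightarrow> coord x b = coord y b"
  shows "x = y"
  using sum_coord[of x] sum_coord[of y] assms by (metis (no_types, lifting) sum.cong)

lemma mult_sum_coord_left: "x * y = (\<Sum>a\<in>B. smul (coord x a) (a * y))"
  by (subst (1) sum_coord[of x, symmetric]) (simp add: sum_distrib_right scale_mult_left)

lemma mult_sum_coord_right: "x * y = (\<Sum>b\<in>B. smul (coord y b) (x * b))"
  by (subst (1) sum_coord[of y, symmetric]) (simp add: sum_distrib_left scale_mult_right)

lemma coord_mult:
  "coord (x * y) g = (\<Sum>(a, b)\<in>B \<times> B. coord x a * (coord y b * coord (a * b) g))"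
  by (subst mult_sum_coord_left, subst mult_sum_coord_right)
    (simp add: coord_sum coord_scale sum_distrib_left sum.cartesian_product)

lemma deg_zero: "deg 0 = 0"
  using deg_add[of 0 0] by simp

lemma deg_sum: "deg (sum f I) = (\<Sum>i\<in>I. deg (f i))"
  by (induction I rule: infinite_finite_induct) (simp_all add: deg_zero deg_add)

lemma deg_eq_sum_coord: "deg x = (\<Sum>b\<in>B. coord x b * deg b)"
  by (subst (1) sum_coord[of x, symmetric]) (simp add: deg_sum deg_scale)

lemma deg_neq_0: "b \<in> B \<Longrightarrow> deg b \<noteq> 0"
  using deg_pos[of b] by auto

lemma cnj_deg: "b \<in> B \<Longrightarrow> cnj (deg b) = deg b"
  using deg_pos Reals_cnj_iff by blast

lemma finite_subset_B: "E \<subseteq> B \<Longrightarrow> finite E"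
  using finite_Basis finite_subset by blast

lemma coord_plus_sum: "E \<subseteq> B \<Longrightarrow> coord (plus_sum E) d = (if d \<in> E then 1 else 0)"
  unfolding plus_sum_def coord_sum
  by (subst sum.cong[OF refl coord_basis]) (auto simp: finite_subset_B)

lemma deg_plus_sum_neq_0:
  assumes "E \<subseteq> B" "E \<noteq> {}"
  shows "deg (plus_sum E) \<noteq> 0"
proof -
  have "0 < (\<Sum>b\<in>E. Re (deg b))"
    using assms deg_pos by (intro sum_pos) (auto simp: finite_subset_B)
  then show ?thesis
    unfolding plus_sum_def deg_sum by (metis Re_sum less_irrefl zero_complex.sel(1))
qed

section \<open>The involution and Frobenius reciprocity\<close>

lemma star_in_B: "b \<in> B \<Longrightarrow> star b \<in> B"
  using star_B by blast

lemma star_inject: "star x = star y \<longleftrightarrow> x = y"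
  by (metis star_star)

lemma star_zero: "star 0 = 0"
  using star_add[of 0 0] by simp

lemma star_sum: "star (sum f I) = (\<Sum>i\<in>I. star (f i))"
  by (induction I rule: infinite_finite_induct) (simp_all add: star_zero star_add)

lemma sum_star_reindex: "(\<Sum>b\<in>B. f (star b)) = (\<Sum>b\<in>B. f b)"
  by (rule sum.reindex_bij_witness[where i = star and j = star]) (auto simp: star_star star_in_B)

lemma coord_star:
  assumes "d \<in> B"
  shows "coord (star x) (star d) = cnj (coord x d)"
proof -
  have "star x = (\<Sum>b\<in>B. smul (cnj (coord x b)) (star b))"
    by (subst (1) sum_coord[of x, symmetric]) (simp add: star_sum star_scale)
  then have "coord (star x) (star d) = (\<Sum>b\<in>B. cnj (coord x b) * coord (star b) (star d))"
    by (simp add: coord_sum coord_scale)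
  also have "\<dots> = (\<Sum>b\<in>B. if d = b then cnj (coord x b) else 0)"
    by (rule sum.cong) (auto simp: coord_basis star_in_B star_inject)
  also have "\<dots> = cnj (coord x d)"
    using assms finite_Basis by simp
  finally show ?thesis .
qed

lemma coord_mult_star_one:
  assumes "d \<in> B"
  shows "coord (x * star d) 1 = coord x d * deg d"
proof -
  have "coord (x * star d) 1 = (\<Sum>a\<in>B. coord x a * coord (a * star d) 1)"
    by (subst mult_sum_coord_left) (simp add: coord_sum coord_scale)
  also have "\<dots> = (\<Sum>a\<in>B. if a = d then coord x a * deg a else 0)"
    using assms by (intro sum.cong) (auto simp: one_coord star_in_B star_star)
  finally show ?thesis
    using assms finite_Basis by simp
qed

text \<open>
  Both sides are the coordinate at \<open>1\<close> of \<open>a b d\<^sup>*\<close>, bracketed in the two possible ways.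
\<close>

lemma frobenius_reciprocity:
  assumes "a \<in> B" "b \<in> B" "d \<in> B"
  shows "coord (a * b) d * deg d = coord (b * star d) (star a) * deg a"
proof -
  have "coord (a * b) d * deg d = coord (a * (b * star d)) 1"
    using assms coord_mult_star_one[of d "a * b"] by (simp add: mult.assoc)
  also have "\<dots> = (\<Sum>y\<in>B. coord (b * star d) y * coord (a * y) 1)"
    by (subst mult_sum_coord_right) (simp add: coord_sum coord_scale)
  also have "\<dots> = (\<Sum>y\<in>B. if y = star a then coord (b * star d) y * deg a else 0)"
    using assms by (intro sum.cong) (auto simp: one_coord star_in_B star_star)
  finally show ?thesis
    using assms finite_Basis by (simp add: star_in_B)
qed

lemma Supp_star:
  assumes "d \<in> B"
  shows "star d \<in> Supp (star x) \<longleftrightarrow> d \<in> Supp x"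
  using assms by (simp add: Supp_def coord_star star_in_B)

lemma Supp_transpose_right:
  assumes "a \<in> B" "b \<in> B" "d \<in> B"
  shows "d \<in> Supp (a * b) \<longleftrightarrow> a \<in> Supp (d * star b)"
proof -
  have "d \<in> Supp (a * b) \<longleftrightarrow> star a \<in> Supp (b * star d)"
    using frobenius_reciprocity[OF assms] assms deg_neq_0
    by (auto simp: Supp_def star_in_B)
  also have "\<dots> \<longleftrightarrow> a \<in> Supp (d * star b)"
    using Supp_star[of a "d * star b"] assms by (simp add: star_mult star_star)
  finally show ?thesis .
qed

lemma Supp_transpose_left:
  assumes "a \<in> B" "b \<in> B" "d \<in> B"
  shows "d \<in> Supp (a * b) \<longleftrightarrow> b \<in> Supp (star a * d)"
  using Supp_star[of d "a * b"] Supp_transpose_right[of "star b" "star a" "star d"]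
    Supp_star[of b "star a * d"] assms
  by (simp add: star_mult star_star star_in_B)

section \<open>The complex product of subsets of the basis\<close>

definition nonneg :: "'a \<Rightarrow> bool" where
  "nonneg x \<longleftrightarrow> (\<forall>b\<in>B. coord x b \<in> \<real>\<^sub>\<ge>\<^sub>0)"

lemma nonneg_plus_sum: "E \<subseteq> B \<Longrightarrow> nonneg (plus_sum E)"
  by (simp add: nonneg_def coord_plus_sum)

lemma nonneg_basis: "b \<in> B \<Longrightarrow> nonneg b"
  by (simp add: nonneg_def coord_basis)

lemma nonneg_mult: "nonneg x \<Longrightarrow> nonneg y \<Longrightarrow> nonneg (x * y)"
  unfolding nonneg_def coord_mult[of x y]
  by (auto intro!: sum_nonneg_Reals nonneg_Reals_mult_I struct_nonneg)

lemma Supp_plus_sum: "E \<subseteq> B \<Longrightarrow> Supp (plus_sum E) = E"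
  by (auto simp: Supp_def coord_plus_sum)

lemma Supp_basis: "b \<in> B \<Longrightarrow> Supp b = {b}"
  by (auto simp: Supp_def coord_basis)

lemma set_mult_subset: "set_mult E D \<subseteq> B"
  by (auto simp: set_mult_def Supp_def)

text \<open>Nonnegative coordinates cannot cancel in a product.\<close>

lemma Supp_mult:
  assumes "nonneg x" "nonneg y"
  shows "Supp (x * y) = set_mult (Supp x) (Supp y)"
proof -
  have "coord (x * y) g = 0 \<longleftrightarrow>
      (\<forall>(a, b)\<in>B \<times> B. coord x a * (coord y b * coord (a * b) g) = 0)" if "g \<in> B" for g
    unfolding coord_mult[of x y] using that assms
    by (subst sum_nonneg_Reals_eq_0_iff)
      (auto simp: finite_Basis nonneg_def intro!: nonneg_Reals_mult_I struct_nonneg)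
  then show ?thesis
    unfolding Supp_def set_mult_def by (simp add: set_eq_iff) blast
qed

lemma set_mult_assoc:
  assumes "E \<subseteq> B" "D \<subseteq> B" "F \<subseteq> B"
  shows "set_mult (set_mult E D) F = set_mult E (set_mult D F)"
proof -
  have "set_mult (set_mult E D) F = Supp (plus_sum E * plus_sum D * plus_sum F)"
    using assms by (simp add: Supp_mult nonneg_mult nonneg_plus_sum Supp_plus_sum)
  also have "\<dots> = set_mult E (set_mult D F)"
    using assms by (simp add: Supp_mult nonneg_mult nonneg_plus_sum Supp_plus_sum mult.assoc)
  finally show ?thesis .
qed

lemma set_mult_mono: "E \<subseteq> E' \<Longrightarrow> D \<subseteq> D' \<Longrightarrow> set_mult E D \<subseteq> set_mult E' D'"
  unfolding set_mult_def by blast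

lemma Supp_plus_sum_mult_basis:
  assumes "E \<subseteq> B" "b \<in> B"
  shows "Supp (plus_sum E * b) = set_mult E {b}"
  using assms by (simp add: Supp_mult nonneg_plus_sum nonneg_basis Supp_plus_sum Supp_basis)

section \<open>Closed subsets\<close>

lemma closed_subsetD: "closed_subset C \<Longrightarrow> C \<subseteq> B"
  by (simp add: closed_subset_def)

lemma one_in_closed_subset:
  assumes "closed_subset C"
  shows "1 \<in> C"
proof -
  obtain c where c: "c \<in> C" "c \<in> B"
    using assms by (auto simp: closed_subset_def)
  then have "1 \<in> Supp (star c * c)"
    using Supp_transpose_left[of "star c" c 1] one_in_B
    by (simp add: star_in_B star_star Supp_basis)
  with assms c show ?thesis
    unfolding closed_subset_def set_mult_def by blast
qed

lemma star_in_closed_subset: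
  assumes "closed_subset C" "c \<in> C"
  shows "star c \<in> C"
proof -
  have "c \<in> B"
    using assms closed_subsetD by blast
  then have "star c \<in> Supp (star c * 1)"
    by (simp add: Supp_basis star_in_B)
  then show ?thesis
    using assms one_in_closed_subset unfolding closed_subset_def set_mult_def by blast
qed

lemma subset_set_mult_closed_left:
  assumes "closed_subset C" "E \<subseteq> B"
  shows "E \<subseteq> set_mult C E"
  using assms one_in_closed_subset Supp_basis unfolding set_mult_def by force

lemma set_mult_closed_self:
  assumes "closed_subset C"
  shows "set_mult C C = C"
proof
  have "star ` C = C"
    using star_in_closed_subset[OF assms] by (force simp: star_star image_iff)
  then show "set_mult C C \<subseteq> C"
    using assms by (simp add: closed_subset_def)
  show "C \<subseteq> set_mult C C"
    using assms subset_set_mult_closed_left closed_subsetD by blast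
qed

text \<open>
  The sets \<open>Cb\<close> behave like the orbits of a group acting on the basis, with \<open>c\<^sup>*\<close> in the role
  of the inverse of \<open>c\<close>: if \<open>d\<close> occurs in \<open>c b\<close>, then \<open>b\<close> occurs in \<open>c\<^sup>* d\<close>.
\<close>

lemma orbit_eq:
  assumes C: "closed_subset C" and "b \<in> B" "d \<in> set_mult C {b}"
  shows "set_mult C {d} = set_mult C {b}"
proof
  have CB: "C \<subseteq> B" and dB: "d \<in> B"
    using assms closed_subsetD set_mult_subset by blast+
  have absorb: "set_mult C (set_mult C {x}) = set_mult C {x}" if "x \<in> B" for x
    using set_mult_assoc[of C C "{x}"] set_mult_closed_self[OF C] CB that by simp
  show "set_mult C {d} \<subseteq> set_mult C {b}"
    using set_mult_mono[of C C "{d}" "set_mult C {b}"] absorb[OF assms(2)] assms(3) by auto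
  obtain c where c: "c \<in> C" "d \<in> Supp (c * b)"
    using assms(3) by (auto simp: set_mult_def)
  then have "b \<in> Supp (star c * d)"
    using Supp_transpose_left[of c b d] CB dB assms(2) by blast
  then have "b \<in> set_mult C {d}"
    using star_in_closed_subset[OF C c(1)] by (auto simp: set_mult_def)
  then show "set_mult C {b} \<subseteq> set_mult C {d}"
    using set_mult_mono[of C C "{b}" "set_mult C {d}"] absorb[OF dB] by auto
qed

section \<open>Absorption\<close>

text \<open>
  For \<open>d \<in> D\<close>, Frobenius reciprocity turns the coordinate of \<open>D\<^sup>+ c\<close> at \<open>d\<close> into
  \<open>|d|\<^sup>-\<^sup>1\<close> times the degree of the part of \<open>c d\<^sup>*\<close> supported on \<open>D\<^sup>*\<close>. The hypothesis on
  \<open>c\<^sup>*\<close> says that this part is all of \<open>c d\<^sup>*\<close>.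
\<close>

lemma plus_sum_absorb:
  assumes D: "D \<subseteq> B" and c: "c \<in> B"
    and Dc: "set_mult D {c} \<subseteq> D" and Dc': "set_mult D {star c} \<subseteq> D"
  shows "plus_sum D * c = smul (deg c) (plus_sum D)"
proof (rule coord_eqI)
  fix d assume d: "d \<in> B"
  have expand: "coord (plus_sum D * c) d = (\<Sum>x\<in>D. coord (x * c) d)"
    by (simp add: plus_sum_def sum_distrib_right coord_sum)
  show "coord (plus_sum D * c) d = coord (smul (deg c) (plus_sum D)) d"
  proof (cases "d \<in> D")
    case False
    then have "d \<notin> Supp (plus_sum D * c)"
      using Supp_plus_sum_mult_basis[OF D c] Dc by blast
    then show ?thesis
      using False d D by (simp add: Supp_def coord_scale coord_plus_sum)
  next
    case True
    have "coord (plus_sum D * c) d * deg d = (\<Sum>x\<in>D. coord (c * star d) (star x) * deg x)"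
      unfolding expand sum_distrib_right
      using D c d frobenius_reciprocity by (intro sum.cong) auto
    also have "\<dots> = (\<Sum>x\<in>B. coord (c * star d) (star x) * deg x)"
    proof (rule sum.mono_neutral_left)
      show "\<forall>x\<in>B - D. coord (c * star d) (star x) * deg x = 0"
      proof
        fix x assume x: "x \<in> B - D"
        then have "x \<notin> Supp (d * star c)"
          using True Dc' by (auto simp: set_mult_def)
        then have "star x \<notin> Supp (c * star d)"
          using x Supp_star[of x "d * star c"] by (simp add: star_mult star_star)
        then show "coord (c * star d) (star x) * deg x = 0"
          using x by (simp add: Supp_def star_in_B)
      qed
    qed (use D finite_Basis in auto)
    also have "\<dots> = (\<Sum>x\<in>B. coord (c * star d) (star x) * deg (star x))"
      by (simp add: deg_star)
    also have "\<dots> = deg (c * star d)"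
      by (subst deg_eq_sum_coord) (rule sum_star_reindex)
    also have "\<dots> = deg c * deg d"
      using d by (simp add: deg_mult deg_star)
    finally show ?thesis
      using deg_neq_0[OF d] True D by (simp add: coord_scale coord_plus_sum)
  qed
qed

lemma plus_sum_absorb_closed:
  assumes "closed_subset C" "D \<subseteq> B" "set_mult D C \<subseteq> D"
  shows "plus_sum D * plus_sum C = smul (deg (plus_sum C)) (plus_sum D)"
proof -
  have "plus_sum D * c = smul (deg c) (plus_sum D)" if "c \<in> C" for c
  proof (rule plus_sum_absorb)
    show "set_mult D {c} \<subseteq> D" "set_mult D {star c} \<subseteq> D"
      using assms that star_in_closed_subset set_mult_mono[of D D _ C] by blast+
    show "c \<in> B"
      using that assms closed_subsetD by blast
  qed (rule assms)
  then show ?thesis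
    by (simp add: plus_sum_def[of C] sum_distrib_left deg_sum scale_sum_left)
qed

lemma plus_sum_basis_absorb_left:
  assumes "E \<subseteq> B"
  shows "plus_sum E * plus_sum B = smul (deg (plus_sum E)) (plus_sum B)"
proof -
  have star_plus: "star (plus_sum B) = plus_sum B"
    unfolding plus_sum_def star_sum by (rule sum_star_reindex)
  have "c * plus_sum B = smul (deg c) (plus_sum B)" if "c \<in> B" for c
  proof -
    have "plus_sum B * star c = smul (deg (star c)) (plus_sum B)"
      using that by (intro plus_sum_absorb) (auto simp: star_in_B set_mult_subset)
    then have "star (plus_sum B * star c) = star (smul (deg c) (plus_sum B))"
      using that by (simp add: deg_star)
    then show ?thesis
      using that by (simp add: star_mult star_star star_scale star_plus cnj_deg)
  qed
  then show ?thesis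
    using assms
    by (simp add: plus_sum_def[of E] sum_distrib_right deg_sum scale_sum_left subset_iff)
qed

section \<open>The maximum principle\<close>

text \<open>
  The invariance of \<open>v\<close> says that its coordinate at \<open>d\<close> is an average of the coordinates of
  \<open>v\<close>, where the coordinate at \<open>f\<close> is weighted by the coordinate of \<open>E\<^sup>+ f\<close> at \<open>d\<close>. These
  weights have total \<open>|E\<^sup>+|\<close> because \<open>E\<^sup>+ B\<^sup>+ = |E\<^sup>+| B\<^sup>+\<close>. An average attains the maximum only
  if every value of positive weight does.
\<close>

lemma invariant_coord_maximum:
  assumes E: "E \<subseteq> B" and v: "nonneg v"
    and inv: "plus_sum E * v = smul (deg (plus_sum E)) v"
    and d: "d \<in> B" and max: "\<And>f. f \<in> B \<Longrightarrow> Re (coord v f) \<le> Re (coord v d)"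
    and f: "f \<in> B" "d \<in> set_mult E {f}"
  shows "coord v f = coord v d"
proof -
  define w where "w g = coord (plus_sum E * g) d" for g
  have "(\<Sum>g\<in>B. coord v g * w g) = coord (plus_sum E * v) d"
    unfolding w_def by (subst (2) mult_sum_coord_right) (simp add: coord_sum coord_scale)
  also have "\<dots> = deg (plus_sum E) * coord v d"
    by (simp add: inv coord_scale)
  finally have average: "(\<Sum>g\<in>B. coord v g * w g) = deg (plus_sum E) * coord v d" .
  have "(\<Sum>g\<in>B. w g) = coord (plus_sum E * plus_sum B) d"
    by (simp add: w_def plus_sum_def[of B] sum_distrib_left coord_sum)
  also have "\<dots> = deg (plus_sum E)"
    using d by (simp add: plus_sum_basis_absorb_left[OF E] coord_scale coord_plus_sum)
  finally have total: "(\<Sum>g\<in>B. w g) = deg (plus_sum E)" .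
  have "(\<Sum>g\<in>B. (coord v d - coord v g) * w g) = 0"
    by (simp add: left_diff_distrib sum_subtractf average total flip: sum_distrib_left)
  moreover have "(coord v d - coord v g) * w g \<in> \<real>\<^sub>\<ge>\<^sub>0" if "g \<in> B" for g
  proof (rule nonneg_Reals_mult_I)
    show "coord v d - coord v g \<in> \<real>\<^sub>\<ge>\<^sub>0"
      using v d that max by (auto simp: nonneg_def complex_nonneg_Reals_iff)
    show "w g \<in> \<real>\<^sub>\<ge>\<^sub>0"
      using nonneg_mult[OF nonneg_plus_sum[OF E] nonneg_basis[OF that]] d
      by (simp add: w_def nonneg_def)
  qed
  ultimately have "(coord v d - coord v f) * w f = 0"
    using f(1) finite_Basis by (subst (asm) sum_nonneg_Reals_eq_0_iff) auto
  moreover have "w f \<noteq> 0"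
    using f(2) Supp_plus_sum_mult_basis[OF E f(1)] by (auto simp: w_def Supp_def)
  ultimately show ?thesis
    by simp
qed

text \<open>
  \<open>C\<^sup>+ b\<close> has nonnegative coordinates and is invariant because \<open>C\<^sup>+ C\<^sup>+ = |C\<^sup>+| C\<^sup>+\<close>.
  The largest coordinate of \<open>C\<^sup>+ b\<close> is attained at some \<open>d \<in> Cb\<close>, hence on all of
  \<open>Cd = Cb\<close>, and this is the support of \<open>C\<^sup>+ b\<close>.
\<close>

lemma plus_sum_mult_basis:
  assumes C: "closed_subset C" and b: "b \<in> B"
  shows "\<exists>r. r \<noteq> 0 \<and> plus_sum C * b = smul (complex_of_real r) (plus_sum (set_mult C {b}))"
proof -
  have CB: "C \<subseteq> B"
    using C by (rule closed_subsetD)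
  define v where "v = plus_sum C * b"
  have nn: "nonneg v"
    unfolding v_def by (intro nonneg_mult nonneg_plus_sum nonneg_basis CB b)
  have supp: "Supp v = set_mult C {b}"
    unfolding v_def by (rule Supp_plus_sum_mult_basis[OF CB b])
  have inv: "plus_sum C * v = smul (deg (plus_sum C)) v"
    using plus_sum_absorb_closed[OF C CB] set_mult_closed_self[OF C]
    by (simp add: v_def scale_mult_left flip: mult.assoc)
  obtain d where d: "d \<in> B" and max: "\<And>f. f \<in> B \<Longrightarrow> Re (coord v f) \<le> Re (coord v d)"
  proof -
    let ?A = "(\<lambda>f. Re (coord v f)) ` B"
    have A: "finite ?A" "?A \<noteq> {}"
      using finite_Basis b by auto
    obtain d where "d \<in> B" "Max ?A = Re (coord v d)"
      using Max_in[OF A] by blast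
    moreover have "Re (coord v f) \<le> Max ?A" if "f \<in> B" for f
      using A(1) that by (intro Max_ge) auto
    ultimately show thesis
      using that by metis
  qed
  have b_orbit: "b \<in> set_mult C {b}"
    using subset_set_mult_closed_left[OF C, of "{b}"] b by simp
  then have "coord v b \<noteq> 0"
    using supp by (auto simp: Supp_def)
  then have "Re (coord v b) > 0"
    using nn b by (auto simp: nonneg_def complex_nonneg_Reals_iff complex_eq_iff less_le)
  then have pos: "Re (coord v d) > 0"
    using max[OF b] by simp
  then have "d \<in> Supp v"
    using d by (auto simp: Supp_def)
  then have orbit: "set_mult C {d} = set_mult C {b}"
    using orbit_eq[OF C b] supp by simp
  have const: "coord v f = coord v d" if "f \<in> set_mult C {b}" for f
  proof (rule invariant_coord_maximum[OF CB nn inv d max])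
    show "f \<in> B"
      using that set_mult_subset by blast
    show "d \<in> set_mult C {f}"
      using orbit_eq[OF C b that] \<open>d \<in> Supp v\<close> supp by simp
  qed
  have "v = smul (complex_of_real (Re (coord v d))) (plus_sum (set_mult C {b}))"
  proof (rule coord_eqI)
    fix f assume "f \<in> B"
    moreover have "coord v d = complex_of_real (Re (coord v d))"
      using nn d by (auto simp: nonneg_def complex_nonneg_Reals_iff complex_eq_iff)
    ultimately show "coord v f =
        coord (smul (complex_of_real (Re (coord v d))) (plus_sum (set_mult C {b}))) f"
      using const[of f] supp
      by (auto simp: coord_scale coord_plus_sum set_mult_subset Supp_def)
  qed
  then show ?thesis
    using pos v_def by (metis less_irrefl)
qed

lemma plus_sum_mult_basis_alpha:
  assumes C: "closed_subset C" and b: "b \<in> B"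
  shows "plus_sum C * b = smul (complex_of_real (alpha C b)) (plus_sum (set_mult C {b}))"
proof -
  have "b \<in> set_mult C {b}"
    using subset_set_mult_closed_left[OF C, of "{b}"] b by simp
  then have coord_b: "coord (plus_sum (set_mult C {b})) b = 1"
    by (simp add: coord_plus_sum set_mult_subset)
  have "\<exists>!r. r \<noteq> 0 \<and> plus_sum C * b = smul (complex_of_real r) (plus_sum (set_mult C {b}))"
  proof (rule ex_ex1I[OF plus_sum_mult_basis[OF C b]])
    fix r s :: real
    assume "r \<noteq> 0 \<and> plus_sum C * b = smul (complex_of_real r) (plus_sum (set_mult C {b}))"
      and "s \<noteq> 0 \<and> plus_sum C * b = smul (complex_of_real s) (plus_sum (set_mult C {b}))"
    then have "coord (smul (complex_of_real r) (plus_sum (set_mult C {b}))) b =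
        coord (smul (complex_of_real s) (plus_sum (set_mult C {b}))) b"
      by metis
    then show "r = s"
      by (simp add: coord_scale coord_b)
  qed
  from theI'[OF this] show ?thesis
    unfolding alpha_def by blast
qed

section \<open>The idempotent of a normal closed subset\<close>

definition closed_idem :: "'a set \<Rightarrow> 'a" where
  "closed_idem C = smul (inverse (deg (plus_sum C))) (plus_sum C)"

lemma mult_closed_idem:
  assumes "closed_subset C" "D \<subseteq> B" "set_mult D C \<subseteq> D"
  shows "plus_sum D * closed_idem C = plus_sum D"
proof -
  have "deg (plus_sum C) \<noteq> 0"
    using assms(1) by (intro deg_plus_sum_neq_0) (auto simp: closed_subset_def)
  then show ?thesis
    by (simp add: closed_idem_def scale_mult_right plus_sum_absorb_closed[OF assms])
qed

text \<open>Normality gives \<open>(Cb)C = (bC)C = b(CC) = bC = Cb\<close>.\<close>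

lemma normal_orbit_mult:
  assumes "normal_closed_subset C" "b \<in> B"
  shows "set_mult (set_mult C {b}) C = set_mult C {b}"
proof -
  have C: "closed_subset C" and comm: "set_mult {b} C = set_mult C {b}"
    using assms by (auto simp: normal_closed_subset_def)
  have "set_mult (set_mult C {b}) C = set_mult {b} (set_mult C C)"
    using assms(2) closed_subsetD[OF C] by (simp add: set_mult_assoc flip: comm)
  then show ?thesis
    by (simp add: set_mult_closed_self[OF C] comm)
qed

lemma closed_idem_mult_basis:
  assumes "normal_closed_subset C" "b \<in> B"
  shows "closed_idem C * b = smul (complex_of_real (alpha C b)) (quot_elem C b)"
  using assms
  by (simp add: closed_idem_def quot_elem_def scale_mult_left normal_orbit_mult
      plus_sum_mult_basis_alpha normal_closed_subset_def mult.commute)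

lemma quot_elem_one:
  assumes "closed_subset C"
  shows "quot_elem C 1 = closed_idem C"
proof -
  have CB: "C \<subseteq> B"
    using assms by (rule closed_subsetD)
  have "set_mult C {1} = C"
    using Supp_plus_sum_mult_basis[OF CB one_in_B] Supp_plus_sum[OF CB] by simp
  then show ?thesis
    by (simp add: quot_elem_def closed_idem_def set_mult_closed_self[OF assms])
qed

lemma closed_idem_mult_in_quot_space:
  assumes "normal_closed_subset C"
  shows "closed_idem C * x \<in> quot_space C"
proof -
  have "closed_idem C * x = (\<Sum>b\<in>B. smul (coord x b) (closed_idem C * b))"
    by (rule mult_sum_coord_right)
  then show ?thesis
    using assms unfolding quot_space_def
    by (simp add: closed_idem_mult_basis span_sum span_scale span_base)
qed

text \<open>
  Each \<open>e b\<close> is a multiple of \<open>(Cb)\<^sup>+\<close>, and \<open>(Cb)C = Cb\<close>, so \<open>(Cb)\<^sup>+\<close> absorbs \<open>e\<close> on the right.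
  This identity makes \<open>x \<mapsto> e x\<close> multiplicative.
\<close>

lemma closed_idem_mult_closed_idem:
  assumes "normal_closed_subset C"
  shows "closed_idem C * x * closed_idem C = closed_idem C * x"
proof -
  have basis: "closed_idem C * b * closed_idem C = closed_idem C * b" if "b \<in> B" for b
    using assms that mult_closed_idem[of C "set_mult C {b}"]
    by (simp add: closed_idem_mult_basis quot_elem_def scale_mult_left normal_orbit_mult
        set_mult_subset normal_closed_subset_def)
  have "closed_idem C * x * closed_idem C =
      (\<Sum>b\<in>B. smul (coord x b) (closed_idem C * b * closed_idem C))"
    by (subst mult_sum_coord_right[of "closed_idem C" x])
      (simp add: sum_distrib_right scale_mult_left)
  also have "\<dots> = closed_idem C * x"
    by (subst (2) mult_sum_coord_right) (simp add: basis)
  finally show ?thesis .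
qed

section \<open>The lift of a representation\<close>

text \<open>
  On \<open>B\<close> this is \<open>e b = \<alpha>\<^sub>b (b/C)\<close>. Linearity extends it to all of the algebra, since \<open>e x\<close> stays in
  the subspace on which \<open>\<psi>\<close> is linear.
\<close>

lemma lift_rep_eq:
  assumes C: "normal_closed_subset C"
    and \<psi>: "is_representation smul (quot_space C) e \<psi>"
  shows "lift_rep C \<psi> x = \<psi> (closed_idem C * x)"
proof -
  have \<psi>_add: "\<psi> (u + v) = \<psi> u + \<psi> v" if "u \<in> quot_space C" "v \<in> quot_space C" for u v
    using \<psi> that by (simp add: is_representation_def)
  have \<psi>_scale: "\<psi> (smul c u) = mscale c (\<psi> u)" if "u \<in> quot_space C" for c u
    using \<psi> that by (simp add: is_representation_def)
  interpret L: Vector_Spaces.linear smul mscale "lift_rep C \<psi>"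
    by (rule linear_lift_rep)
  have "x \<in> span B"
    by (simp add: span_Basis)
  then show ?thesis
  proof (induction rule: span_induct_alt)
    case base
    have "\<psi> (smul 0 0) = mscale 0 (\<psi> 0)"
      by (rule \<psi>_scale) (simp add: quot_space_def span_zero)
    then show ?case
      by (simp add: L.zero)
  next
    case (step c b y)
    have "quot_elem C b \<in> quot_space C"
      using step by (simp add: quot_space_def span_base)
    then have "lift_rep C \<psi> b = \<psi> (closed_idem C * b)"
      using step C by (simp add: lift_rep_basis closed_idem_mult_basis \<psi>_scale)
    then have "lift_rep C \<psi> (smul c b + y) =
        \<psi> (smul c (closed_idem C * b)) + \<psi> (closed_idem C * y)"
      using step closed_idem_mult_in_quot_space[OF C] by (simp add: L.add L.scale \<psi>_scale)
    also have "\<dots> = \<psi> (closed_idem C * (smul c b + y))"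
      using closed_idem_mult_in_quot_space[OF C]
      by (subst \<psi>_add[symmetric])
        (auto simp: quot_space_def span_scale distrib_left scale_mult_right)
    finally show ?case .
  qed
qed

theorem is_representation_lift_rep:
  assumes C: "normal_closed_subset C"
    and \<psi>: "is_representation smul (quot_space C) (quot_elem C 1) \<psi>"
  shows "is_representation smul UNIV 1 (lift_rep C \<psi>)"
proof -
  interpret L: Vector_Spaces.linear smul mscale "lift_rep C \<psi>"
    by (rule linear_lift_rep)
  note lift = lift_rep_eq[OF C \<psi>]
  have "lift_rep C \<psi> (x * y) = lift_rep C \<psi> x ** lift_rep C \<psi> y" for x y
  proof -
    have "closed_idem C * (x * y) = (closed_idem C * x) * (closed_idem C * y)"
      using closed_idem_mult_closed_idem[OF C] by (metis mult.assoc)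
    then show ?thesis
      using \<psi> closed_idem_mult_in_quot_space[OF C]
      by (simp add: lift is_representation_def)
  qed
  moreover have "lift_rep C \<psi> 1 = mat 1"
    using \<psi> C by (simp add: lift is_representation_def normal_closed_subset_def
        flip: quot_elem_one)
  ultimately show ?thesis
    by (simp add: is_representation_def L.add L.scale)
qed

end

theorem theorem3p3:
  fixes smul :: "complex \<Rightarrow> 'a::ring_1 \<Rightarrow> 'a"
    and B C :: "'a set"
    and star :: "'a \<Rightarrow> 'a"
    and deg :: "'a \<Rightarrow> complex"
    and \<psi> :: "'a \<Rightarrow> complex^'s^'s"
  assumes "table_algebra smul B star deg"
    and "table_algebra.normal_closed_subset smul B star C"
    and "is_representation smul (table_algebra.quot_space smul B deg C)
           (table_algebra.quot_elem smul B deg C 1) \<psi>"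
  shows "is_representation smul UNIV 1 (table_algebra.lift_rep smul B deg C \<psi>)"
  using assms by (rule table_algebra.is_representation_lift_rep)

end
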